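(* Let $X$ be a Banach space, let $F\subset X$ be a nonempty closed bounded convex set with $0\in\operatorname{int}F$, and let $\Omega_1,\dots,\Omega_n$ be nonempty closed convex subsets of $X$. Let $\bar x\in X$ be such that $\Pi^F_{\Omega_i}(\bar x)\ne\emptyset$ whenever $\bar x\notin\Omega_i$, $i=1,\dots,n$. Then $\bar x$ is an optimal solution (global minimizer) of the generalized Fermat-Torricelli problem $$\text{minimize } T(x):=\sum_{i=1}^n T^F_{\Omega_i}(x),\quad x\in X,$$ if and only if $$0\in\sum_{i=1}^n A_i(\bar x),$$ where $A_i(\bar x)=-\partial\rho_F(\omega-\bar x)\cap N(\omega;\Omega_i)$ for any $\omega\in\Pi^F_{\Omega_i}(\bar x)$, $i=1,\dots,n$.
   Context: $X^*$ is the topological dual of $X$ with pairing $\langle\cdot,\cdot\rangle$. For a nonempty closed set $\Omega\subset X$, the minimal time function is $T^F_\Omega(x):=\inf\{t\ge 0 \mid \Omega\cap(x+tF)\ne\emptyset\}$, and the generalized projection is $\Pi^F_\Omega(x):=(x+T^F_\Omega(x)F)\cap\Omega$ (which equals $\{x\}$ when $x\in\Omega$). The Minkowski gauge is $\rho_F(x):=\inf\{t\ge 0\mid x\in tF\}$, and $\partial\rho_F(u)=\{x^*\in X^*\mid \langle x^*,x-u\rangle\le\rho_F(x)-\rho_F(u)\ \forall x\in X\}$ is its convex subdifferential. For a convex set $\Omega$ and $\omega\in\Omega$, $N(\omega;\Omega)=\{x^*\in X^*\mid\langle x^*,x-\omega\rangle\le0\ \forall x\in\Omega\}$. In general $A_i(x):=\bigcup_{\omega\in\Pi^F_{\Omega_i}(x)}[-\partial\rho_F(\omega-x)\cap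 N(\omega;\Omega_i)]$; in the present convex setting the set $-\partial\rho_F(\omega-x)\cap N(\omega;\Omega_i)$ does not depend on the choice of $\omega\in\Pi^F_{\Omega_i}(x)$, so $A_i(x)$ is equal to it for any such $\omega$. Sums of sets are Minkowski sums. *)

theory Defs
  imports "HOL-Analysis.Analysis"
begin

(* The topological dual of 'a is the type 'a \<Rightarrow>\<^sub>L real of bounded linear functionals;
   the pairing of xs and x is blinfun_apply xs x. *)

(* A real-valued infimum: if 0 is an interior point of F and \<Omega> is nonempty, the set of
   admissible times is nonempty, so the value +\<infinity> of the infimum over the empty set never
   occurs. The same applies to gauge_fun below. *)
definition minimal_time :: "'a::real_normed_vector set \<Rightarrow> 'a set \<Rightarrow> 'a \<Rightarrow> real" where
  "minimal_time F \<Omega> x = Inf {t. t \<ge> 0 \<and> \<Omega> \<inter> (\<lambda>f. x + t *\<^sub>R f) ` F \<noteq> {}}"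

definition gen_projection :: "'a::real_normed_vector set \<Rightarrow> 'a set \<Rightarrow> 'a \<Rightarrow> 'a set" where
  "gen_projection F \<Omega> x = (\<lambda>f. x + minimal_time F \<Omega> x *\<^sub>R f) ` F \<inter> \<Omega>"

definition gauge_fun :: "'a::real_normed_vector set \<Rightarrow> 'a \<Rightarrow> real" where
  "gauge_fun F x = Inf {t. t \<ge> 0 \<and> x \<in> (\<lambda>f. t *\<^sub>R f) ` F}"

definition subdifferential ::
    "('a::real_normed_vector \<Rightarrow> real) \<Rightarrow> 'a \<Rightarrow> ('a \<Rightarrow>\<^sub>L real) set" where
  "subdifferential f u = {xs. \<forall>x. blinfun_apply xs (x - u) \<le> f x - f u}"

definition normal_cone :: "'a::real_normed_vector \<Rightarrow> 'a set \<Rightarrow> ('a \<Rightarrow>\<^sub>L real) set" where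
  "normal_cone \<omega> \<Omega> = {xs. \<forall>x\<in>\<Omega>. blinfun_apply xs (x - \<omega>) \<le> 0}"

(* The negative of a set is written uminus ` S, since - S denotes the complement. *)
definition normal_subgradients ::
    "'a::real_normed_vector set \<Rightarrow> 'a set \<Rightarrow> 'a \<Rightarrow> 'a \<Rightarrow> ('a \<Rightarrow>\<^sub>L real) set" where
  "normal_subgradients F \<Omega> x \<omega> =
     uminus ` subdifferential (gauge_fun F) (\<omega> - x) \<inter> normal_cone \<omega> \<Omega>"

definition A_set ::
    "'a::real_normed_vector set \<Rightarrow> 'a set \<Rightarrow> 'a \<Rightarrow> ('a \<Rightarrow>\<^sub>L real) set" where
  "A_set F \<Omega> x = (\<Union>\<omega>\<in>gen_projection F \<Omega> x. normal_subgradients F \<Omega> x \<omega>)"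

end

theory Submission
  imports Defs
begin

text \<open>
  A point minimizes a function exactly if \<open>0\<close> is a subgradient there, so the theorem asks for the
  subdifferential of a sum of minimal time functions. Two facts compute it.

  The first identifies each \<open>A\<^sub>i\<close> with the subdifferential of the \<open>i\<close>-th minimal time function
  (\<open>normal_subgradients_eq_subdifferential\<close>). Writing \<open>\<rho>\<close> for the gauge of \<open>F\<close>, the minimal time from \<open>x\<close>
  to \<open>\<Omega>\<close> is the infimum of \<open>\<rho> (\<omega> - x)\<close> over \<open>\<omega> \<in> \<Omega>\<close>, and the projection consists of the points \<open>\<omega>\<close> that
  attain it. A subgradient at \<open>x\<close> can therefore be tested by translating the starting point
  together with the point of \<open>\<Omega>\<close> to be reached, which gives the normal cone condition, and by moving
  only the starting point, with \<open>\<omega>\<close> still to be reached, which gives the condition on \<open>\<rho>\<close>.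
  Since the subdifferential does not refer to \<open>\<omega>\<close>, this also yields independence of the projection point.

  The second is the Moreau-Rockafellar sum rule for convex functions that are continuous at the point
  (\<open>subdifferential_sum\<close>). Minimal time functions qualify: they inherit convexity from \<open>\<rho>\<close> and \<open>\<Omega>\<close>, and
  they are Lipschitz because \<open>\<rho>\<close> is bounded by a multiple of the norm when \<open>0\<close> is interior to \<open>F\<close>. The sum
  rule for two functions is a linear minorant problem for the value function of the shifted
  minimization problem, hence an instance of the Hahn-Banach theorem. That theorem is proved in
  the form that a sublinear function dominates a linear one: by Zorn's lemma there is a minimal
  sublinear function below it, and a minimal sublinear function is linear.
\<close>

section \<open>Infima of combined families\<close>

text \<open>
  The functions constructed below are infima of families of real numbers in which a member for a
  combined argument is built from members for the given arguments, at no more than the combined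
  cost. This one estimate gives subadditivity (weights \<open>1\<close> and \<open>1\<close>), positive homogeneity (weights
  \<open>c\<close> and \<open>0\<close>) and convexity (weights \<open>u\<close> and \<open>v\<close> with sum \<open>1\<close>) of such infima.
\<close>

lemma cInf_linear_combination_le:
  fixes A B C :: "real set"
  assumes "A \<noteq> {}" "B \<noteq> {}" "bdd_below C" "u \<ge> 0" "v \<ge> 0"
    and combine: "\<And>a b. a \<in> A \<Longrightarrow> b \<in> B \<Longrightarrow> \<exists>c\<in>C. c \<le> u * a + v * b"
  shows "Inf C \<le> u * Inf A + v * Inf B"
proof (rule field_le_epsilon)
  fix e :: real
  assume "e > 0"
  define d where "d = e / (u + v + 1)"
  have "d > 0"
    using \<open>e > 0\<close> assms(4,5) by (simp add: d_def)
  obtain a where a: "a \<in> A" "a < Inf A + d"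
    using cInf_lessD[OF \<open>A \<noteq> {}\<close>, of "Inf A + d"] \<open>d > 0\<close> by auto
  obtain b where b: "b \<in> B" "b < Inf B + d"
    using cInf_lessD[OF \<open>B \<noteq> {}\<close>, of "Inf B + d"] \<open>d > 0\<close> by auto
  obtain c where "c \<in> C" "c \<le> u * a + v * b"
    using combine a b by blast
  then have "Inf C \<le> u * a + v * b"
    using cInf_lower[OF _ \<open>bdd_below C\<close>] by force
  also have "\<dots> \<le> u * (Inf A + d) + v * (Inf B + d)"
    using a b assms(4,5) by (intro add_mono mult_left_mono) auto
  also have "\<dots> \<le> u * Inf A + v * Inf B + (u + v + 1) * d"
    using \<open>d > 0\<close> by (simp add: algebra_simps)
  also have "(u + v + 1) * d = e"
    using assms(4,5) by (simp add: d_def)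
  finally show "Inf C \<le> u * Inf A + v * Inf B + e" .
qed

section \<open>Linear minorants of sublinear and convex functions\<close>

definition sublinear :: "('a::real_vector \<Rightarrow> real) \<Rightarrow> bool" where
  "sublinear p \<longleftrightarrow> (\<forall>x y. p (x + y) \<le> p x + p y) \<and> (\<forall>c x. c > 0 \<longrightarrow> p (c *\<^sub>R x) \<le> c * p x)"

lemma sublinearI:
  assumes "\<And>x y. p (x + y) \<le> p x + p y" "\<And>c x. c > 0 \<Longrightarrow> p (c *\<^sub>R x) \<le> c * p x"
  shows "sublinear p"
  using assms by (simp add: sublinear_def)

lemma sublinear_add: "sublinear p \<Longrightarrow> p (x + y) \<le> p x + p y"
  by (simp add: sublinear_def)

lemma sublinear_scaleR_le: "sublinear p \<Longrightarrow> c > 0 \<Longrightarrow> p (c *\<^sub>R x) \<le> c * p x"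
  by (simp add: sublinear_def)

lemma sublinear_zero:
  assumes "sublinear p"
  shows "p 0 = 0"
  using sublinear_scaleR_le[OF assms, of 2 0] sublinear_scaleR_le[OF assms, of "1/2" 0] by simp

lemma sublinear_scaleR:
  assumes "sublinear p" "c \<ge> 0"
  shows "p (c *\<^sub>R x) = c * p x"
proof (cases "c = 0")
  case False
  with assms have "c > 0" by simp
  then have "p x \<le> inverse c * p (c *\<^sub>R x)"
    using sublinear_scaleR_le[OF assms(1), of "inverse c" "c *\<^sub>R x"] by simp
  then have "c * p x \<le> p (c *\<^sub>R x)"
    using \<open>c > 0\<close> by (simp add: field_simps)
  with sublinear_scaleR_le[OF assms(1) \<open>c > 0\<close>, of x] show ?thesis by simp
qed (simp add: sublinear_zero[OF assms(1)])

lemma sublinear_neg_le: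
  assumes "sublinear p"
  shows "- p (- x) \<le> p x"
  using sublinear_add[OF assms, of x "- x"] sublinear_zero[OF assms] by simp

text \<open>
  A minorant \<open>q\<close> of \<open>p\<close> satisfies \<open>q x \<ge> - q (- x) \<ge> - p (- x)\<close>, so the pointwise infimum of a chain
  of sublinear minorants is finite; it is again sublinear because finitely many members of a chain
  have a least one. Zorn's lemma for the reversed pointwise order then applies. Working with
  functions on the whole space avoids the extension of functionals from subspaces.
\<close>

lemma exists_minimal_sublinear:
  fixes p :: "'a::real_vector \<Rightarrow> real"
  assumes "sublinear p"
  obtains m where "sublinear m" "m \<le> p" "\<And>q. sublinear q \<Longrightarrow> q \<le> m \<Longrightarrow> q = m"
proof -
  define A where "A = {q. sublinear q \<and> q \<le> p}"
  have "\<exists>m\<in>A. \<forall>a\<in>A. a \<le> m \<longrightarrow> a = m"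
  proof (rule predicate_Zorn[of A "\<lambda>f g. g \<le> f"])
    show "partial_order_on A (relation_of (\<lambda>f g. g \<le> f) A)"
      by (rule partial_order_on_relation_ofI) auto
  next
    fix C
    assume "C \<in> Chains (relation_of (\<lambda>f g. g \<le> f) A)"
    then have CA: "\<And>q. q \<in> C \<Longrightarrow> sublinear q \<and> q \<le> p"
      and total: "\<And>q r. q \<in> C \<Longrightarrow> r \<in> C \<Longrightarrow> r \<le> q \<or> q \<le> r"
      unfolding Chains_def relation_of_def A_def by auto
    show "\<exists>u\<in>A. \<forall>a\<in>C. u \<le> a"
    proof (cases "C = {}")
      case True
      then show ?thesis using assms by (auto simp: A_def)
    next
      case False
      define r where "r x = Inf ((\<lambda>q. q x) ` C)" for x
      have bdd: "bdd_below ((\<lambda>q. q x) ` C)" for x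
      proof (rule bdd_belowI2[of _ "- p (- x)"])
        fix q assume "q \<in> C"
        then show "- p (- x) \<le> q x"
          using CA[of q] sublinear_neg_le[of q x] le_funD[of q p "- x"] by linarith
      qed
      have le: "r \<le> q" if "q \<in> C" for q
        using that bdd by (auto simp: r_def le_fun_def intro: cInf_lower)
      have "sublinear r"
      proof (rule sublinearI)
        fix x y
        \<comment> \<open>The smaller of two members of the chain is a common witness.\<close>
        have "\<exists>c\<in>(\<lambda>q. q (x + y)) ` C. c \<le> 1 * a + 1 * b"
          if ab: "a \<in> (\<lambda>q. q x) ` C" "b \<in> (\<lambda>q. q y) ` C" for a b
        proof -
          obtain q s where qs: "q \<in> C" "s \<in> C" "a = q x" "b = s y"
            using ab by blast
          from total[OF qs(1,2)] show ?thesis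
          proof
            assume "s \<le> q"
            then show ?thesis
              using qs CA[OF qs(2)] sublinear_add[of s x y] le_funD[of s q x]
              by (intro bexI[of _ "s (x + y)"]) auto
          next
            assume "q \<le> s"
            then show ?thesis
              using qs CA[OF qs(1)] sublinear_add[of q x y] le_funD[of q s y]
              by (intro bexI[of _ "q (x + y)"]) auto
          qed
        qed
        then have "r (x + y) \<le> 1 * r x + 1 * r y"
          unfolding r_def by (intro cInf_linear_combination_le) (use False bdd in auto)
        then show "r (x + y) \<le> r x + r y" by simp
      next
        fix c :: real and x
        assume "c > 0"
        have "\<exists>s\<in>(\<lambda>q. q (c *\<^sub>R x)) ` C. s \<le> c * a + 0 * b"
          if "a \<in> (\<lambda>q. q x) ` C" for a b
          using that CA sublinear_scaleR_le[OF _ \<open>c > 0\<close>] by fastforce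
        then have "r (c *\<^sub>R x) \<le> c * r x + 0 * r x"
          unfolding r_def by (intro cInf_linear_combination_le) (use False bdd \<open>c > 0\<close> in auto)
        then show "r (c *\<^sub>R x) \<le> c * r x" by simp
      qed
      moreover have "r \<le> p"
        using False le CA by (meson all_not_in_conv order_trans)
      ultimately show ?thesis
        using le by (auto simp: A_def)
    qed
  qed
  then obtain m where m: "m \<in> A" "\<And>a. a \<in> A \<Longrightarrow> a \<le> m \<Longrightarrow> a = m" by blast
  show thesis
  proof (rule that[of m])
    show "q = m" if "sublinear q" "q \<le> m" for q
      using m that by (auto simp: A_def intro: order_trans)
  qed (use m in \<open>auto simp: A_def\<close>)
qed

text \<open>
  Where additivity fails, \<open>m\<close> can be lowered: for fixed \<open>z\<close>, the function
  \<open>q x = inf {m (x + t z) - t m z | t \<ge> 0}\<close> is sublinear and lies below \<open>m\<close>. By minimality it equals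
  \<open>m\<close>, and the choice \<open>t = 1\<close> gives \<open>m x + m z \<le> m (x + z)\<close>.
\<close>

lemma minimal_sublinear_imp_linear:
  fixes m :: "'a::real_vector \<Rightarrow> real"
  assumes m: "sublinear m" and minimal: "\<And>q. sublinear q \<Longrightarrow> q \<le> m \<Longrightarrow> q = m"
  shows "linear m"
proof -
  have superadditive: "m x + m z \<le> m (x + z)" for x z
  proof -
    define S where "S x = (\<lambda>t. m (x + t *\<^sub>R z) - t * m z) ` {0..}" for x
    define q where "q x = Inf (S x)" for x
    have bdd: "bdd_below (S x)" for x
      unfolding S_def
    proof (rule bdd_belowI2[of _ "- m (- x)"])
      fix t :: real
      assume "t \<in> {0..}"
      then have "t * m z = m (t *\<^sub>R z)"
        using m by (simp add: sublinear_scaleR)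
      also have "\<dots> \<le> m (x + t *\<^sub>R z) + m (- x)"
        using sublinear_add[OF m, of "x + t *\<^sub>R z" "- x"] by simp
      finally show "- m (- x) \<le> m (x + t *\<^sub>R z) - t * m z" by simp
    qed
    have ne: "S x \<noteq> {}" for x by (simp add: S_def)
    have mem: "m (x + t *\<^sub>R z) - t * m z \<in> S x" if "t \<ge> 0" for x t
      using that by (simp add: S_def)
    have q_le: "q x \<le> m (x + t *\<^sub>R z) - t * m z" if "t \<ge> 0" for x t
      unfolding q_def using that by (intro cInf_lower bdd mem)
    have "sublinear q"
    proof (rule sublinearI)
      fix x y
      have "\<exists>c\<in>S (x + y). c \<le> 1 * a + 1 * b" if ab: "a \<in> S x" "b \<in> S y" for a b
      proof -
        obtain s t where st: "s \<ge> 0" "t \<ge> 0" "a = m (x + s *\<^sub>R z) - s * m z"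
          "b = m (y + t *\<^sub>R z) - t * m z"
          using ab by (auto simp: S_def)
        have "m (x + y + (s + t) *\<^sub>R z) \<le> m (x + s *\<^sub>R z) + m (y + t *\<^sub>R z)"
          using sublinear_add[OF m, of "x + s *\<^sub>R z" "y + t *\<^sub>R z"] by (simp add: algebra_simps)
        then show ?thesis
          using st mem[of "s + t" "x + y"] by (intro bexI) (auto simp: distrib_right)
      qed
      then have "q (x + y) \<le> 1 * q x + 1 * q y"
        unfolding q_def by (intro cInf_linear_combination_le) (use ne bdd in auto)
      then show "q (x + y) \<le> q x + q y" by simp
    next
      fix c :: real and x
      assume "c > 0"
      have "\<exists>s\<in>S (c *\<^sub>R x). s \<le> c * a + 0 * b" if a: "a \<in> S x" for a b
      proof -
        obtain t where t: "t \<ge> 0" "a = m (x + t *\<^sub>R z) - t * m z"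
          using a by (auto simp: S_def)
        have "m (c *\<^sub>R x + (c * t) *\<^sub>R z) \<le> c * m (x + t *\<^sub>R z)"
          using sublinear_scaleR_le[OF m \<open>c > 0\<close>, of "x + t *\<^sub>R z"] by (simp add: algebra_simps)
        then show ?thesis
          using t \<open>c > 0\<close> mem[of "c * t" "c *\<^sub>R x"] by (intro bexI) (auto simp: right_diff_distrib)
      qed
      then have "q (c *\<^sub>R x) \<le> c * q x + 0 * q x"
        unfolding q_def by (intro cInf_linear_combination_le) (use ne bdd \<open>c > 0\<close> in auto)
      then show "q (c *\<^sub>R x) \<le> c * q x" by simp
    qed
    moreover have "q \<le> m"
      using q_le[of 0] by (simp add: le_fun_def)
    ultimately have "q = m" by (rule minimal)
    then show ?thesis
      using q_le[of 1 x] by simp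
  qed
  have add: "m (x + y) = m x + m y" for x y
    using superadditive sublinear_add[OF m] by (simp add: order_antisym)
  have minus: "m (- x) = - m x" for x
    using add[of x "- x"] sublinear_zero[OF m] by simp
  have "m (c *\<^sub>R x) = c *\<^sub>R m x" for c x
  proof (cases "c \<ge> 0")
    case False
    then show ?thesis
      using sublinear_scaleR[OF m, of "- c" x] minus[of "c *\<^sub>R x"] by simp
  qed (simp add: sublinear_scaleR[OF m])
  with add show ?thesis by (rule linearI)
qed

lemma Hahn_Banach_sublinear:
  fixes p :: "'a::real_vector \<Rightarrow> real"
  assumes "sublinear p"
  obtains L where "linear L" "\<And>x. L x \<le> p x"
proof -
  obtain m where "sublinear m" "m \<le> p" "\<And>q. sublinear q \<Longrightarrow> q \<le> m \<Longrightarrow> q = m"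
    using exists_minimal_sublinear[OF assms] by blast
  then show thesis
    using minimal_sublinear_imp_linear that le_funD by metis
qed

text \<open>
  The directional derivative \<open>p h = inf {(\<phi> (x + t h) - \<phi> x) / t | t > 0}\<close> is a sublinear function
  below \<open>h \<mapsto> \<phi> (x + h) - \<phi> x\<close>, so any linear minorant of \<open>p\<close> will do. The functional obtained may be
  discontinuous.
\<close>

lemma convex_on_algebraic_subgradient:
  fixes \<phi> :: "'a::real_vector \<Rightarrow> real"
  assumes conv: "convex_on UNIV \<phi>"
  obtains L where "linear L" "\<And>h. L h \<le> \<phi> (x + h) - \<phi> x"
proof -
  have jensen: "\<phi> (u *\<^sub>R a + v *\<^sub>R b) \<le> u * \<phi> a + v * \<phi> b"
    if "u \<ge> 0" "v \<ge> 0" "u + v = 1" for u v a b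
    using conv that by (simp add: convex_on_def)
  define S where "S h = (\<lambda>t. (\<phi> (x + t *\<^sub>R h) - \<phi> x) / t) ` {0<..}" for h
  define p where "p h = Inf (S h)" for h
  have ne: "S h \<noteq> {}" for h by (simp add: S_def)
  have bdd: "bdd_below (S h)" for h
    unfolding S_def
  proof (rule bdd_belowI2[of _ "- (\<phi> (x - h) - \<phi> x)"])
    fix t :: real
    assume "t \<in> {0<..}"
    then have t: "t > 0" by simp
    \<comment> \<open>Convexity along the segment from \<open>x - h\<close> to \<open>x + t h\<close>, which contains \<open>x\<close>,
      bounds all difference quotients in the direction \<open>h\<close> from below.\<close>
    have "x = (1 / (1 + t)) *\<^sub>R (x + t *\<^sub>R h) + (t / (1 + t)) *\<^sub>R (x - h)"
    proof -
      have "(1 / (1 + t)) *\<^sub>R (x + t *\<^sub>R h) + (t / (1 + t)) *\<^sub>R (x - h)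
          = (1 / (1 + t) + t / (1 + t)) *\<^sub>R x"
        by (simp add: algebra_simps)
      also have "1 / (1 + t) + t / (1 + t) = 1"
        using t by (simp add: field_simps)
      finally show ?thesis by simp
    qed
    then have "\<phi> x \<le> 1 / (1 + t) * \<phi> (x + t *\<^sub>R h) + t / (1 + t) * \<phi> (x - h)"
      using jensen[of "1 / (1 + t)" "t / (1 + t)" "x + t *\<^sub>R h" "x - h"] t
      by (simp add: add_divide_distrib[symmetric])
    also have "\<dots> = (\<phi> (x + t *\<^sub>R h) + t * \<phi> (x - h)) / (1 + t)"
      by (simp add: add_divide_distrib)
    finally have "\<phi> x * (1 + t) \<le> \<phi> (x + t *\<^sub>R h) + t * \<phi> (x - h)"
      using t by (simp add: pos_le_divide_eq)
    then show "- (\<phi> (x - h) - \<phi> x) \<le> (\<phi> (x + t *\<^sub>R h) - \<phi> x) / t"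
      using t by (simp add: field_simps)
  qed
  have p_le: "p h \<le> \<phi> (x + h) - \<phi> x" for h
    unfolding p_def by (intro cInf_lower bdd) (auto simp: S_def image_iff intro!: bexI[of _ 1])
  have "sublinear p"
  proof (rule sublinearI)
    fix h k
    have "\<exists>c\<in>S (h + k). c \<le> 1 * a + 1 * b" if ab: "a \<in> S h" "b \<in> S k" for a b
    proof -
      obtain s t where st: "s > 0" "t > 0" "a = (\<phi> (x + s *\<^sub>R h) - \<phi> x) / s"
        "b = (\<phi> (x + t *\<^sub>R k) - \<phi> x) / t"
        using ab by (auto simp: S_def)
      \<comment> \<open>The step with \<open>1 / r = 1 / s + 1 / t\<close>: then \<open>x + r (h + k)\<close> is a convex combination
        of \<open>x + s h\<close> and \<open>x + t k\<close>, and the difference quotients add up.\<close>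
      define r where "r = s * t / (s + t)"
      have r: "r > 0" using st by (simp add: r_def)
      have "r / s = t / (s + t)" "r / t = s / (s + t)"
        using st by (simp_all add: r_def)
      then have sum1: "r / s + r / t = 1"
        using st by (simp add: add_divide_distrib[symmetric] add.commute)
      have "x + r *\<^sub>R (h + k) = (r / s + r / t) *\<^sub>R x + r *\<^sub>R (h + k)"
        by (simp add: sum1)
      also have "\<dots> = (r / s) *\<^sub>R (x + s *\<^sub>R h) + (r / t) *\<^sub>R (x + t *\<^sub>R k)"
        using st by (simp add: algebra_simps)
      finally have "\<phi> (x + r *\<^sub>R (h + k)) \<le> r / s * \<phi> (x + s *\<^sub>R h) + r / t * \<phi> (x + t *\<^sub>R k)"
        using jensen[of "r / s" "r / t" "x + s *\<^sub>R h" "x + t *\<^sub>R k"] r st sum1 by simp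
      then have "\<phi> (x + r *\<^sub>R (h + k)) - \<phi> x
          \<le> r / s * \<phi> (x + s *\<^sub>R h) + r / t * \<phi> (x + t *\<^sub>R k) - (r / s + r / t) * \<phi> x"
        by (simp add: sum1)
      also have "\<dots> = r * (a + b)"
        by (simp add: st(3,4) diff_divide_distrib algebra_simps)
      finally have "(\<phi> (x + r *\<^sub>R (h + k)) - \<phi> x) / r \<le> 1 * a + 1 * b"
        using r by (simp add: pos_divide_le_eq mult.commute)
      then show ?thesis
        using r by (intro bexI[of _ "(\<phi> (x + r *\<^sub>R (h + k)) - \<phi> x) / r"]) (auto simp: S_def)
    qed
    then have "p (h + k) \<le> 1 * p h + 1 * p k"
      unfolding p_def by (intro cInf_linear_combination_le) (use ne bdd in auto)
    then show "p (h + k) \<le> p h + p k" by simp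
  next
    fix c :: real and h
    assume c: "c > 0"
    have "\<exists>s\<in>S (c *\<^sub>R h). s \<le> c * a + 0 * b" if a: "a \<in> S h" for a b
    proof -
      obtain t where t: "t > 0" "a = (\<phi> (x + t *\<^sub>R h) - \<phi> x) / t"
        using a by (auto simp: S_def)
      have "c * a = (\<phi> (x + (t / c) *\<^sub>R (c *\<^sub>R h)) - \<phi> x) / (t / c)"
        using c t by simp
      also have "\<dots> \<in> S (c *\<^sub>R h)"
        unfolding S_def using c t by (intro imageI) simp
      finally show ?thesis by auto
    qed
    then have "p (c *\<^sub>R h) \<le> c * p h + 0 * p h"
      unfolding p_def by (intro cInf_linear_combination_le) (use ne bdd c in auto)
    then show "p (c *\<^sub>R h) \<le> c * p h" by simp
  qed
  then obtain L where "linear L" "\<And>h. L h \<le> p h"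
    using Hahn_Banach_sublinear by blast
  then show thesis
    using p_le that order_trans by metis
qed


section \<open>The sum rule for convex subdifferentials\<close>

text \<open>
  Continuity turns an algebraic subgradient into an element of the topological dual: near \<open>0\<close> the
  increment of \<open>f\<close> is at most \<open>1\<close>, and applying the bound to \<open>h\<close> and to \<open>- h\<close> bounds \<open>L\<close> on a ball.
\<close>

lemma linear_minorant_bounded:
  fixes f :: "'a::real_normed_vector \<Rightarrow> real"
  assumes L: "linear L" and le: "\<And>h. L h \<le> f (x + h) - f x" and cont: "isCont f x"
  shows "bounded_linear L"
proof -
  obtain d where d: "d > 0" "\<And>y. dist y x < d \<Longrightarrow> dist (f y) (f x) < 1"
    using cont[unfolded continuous_at_eps_delta] by (meson zero_less_one)
  have small: "\<bar>L h\<bar> \<le> 1" if "norm h < d" for h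
  proof -
    have "f (x + h) - f x < 1" "f (x - h) - f x < 1"
      using d(2)[of "x + h"] d(2)[of "x - h"] that by (auto simp: dist_norm abs_less_iff)
    then show ?thesis
      using le[of h] le[of "- h"] linear_neg[OF L, of h] by simp
  qed
  have "norm (L h) \<le> norm h * (2 / d)" for h
  proof (cases "h = 0")
    case False
    define c where "c = d / (2 * norm h)"
    have "c > 0" using False d by (simp add: c_def)
    moreover have "norm (c *\<^sub>R h) < d"
      using False d by (simp add: c_def)
    ultimately have "c * \<bar>L h\<bar> \<le> 1"
      using small[of "c *\<^sub>R h"] by (simp add: linear_scale[OF L] abs_mult)
    then show ?thesis
      using False d by (simp add: c_def field_simps)
  qed (simp add: linear_0[OF L])
  then show ?thesis
    using linear_add[OF L] linear_scale[OF L] by (intro bounded_linear_intro[of L "2 / d"])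
qed

text \<open>
  Subtracting \<open>xs\<close> from \<open>g\<close> makes \<open>x\<close> a minimizer of \<open>f + k\<close>, where \<open>k = g - xs\<close>. The function
  \<open>\<Phi> h = inf {f (v + h) + k v | v}\<close> measures how the minimal value changes when the two arguments are
  shifted apart. It is convex, so it has an algebraic subgradient \<open>L\<close> at \<open>0\<close>. Shifting the argument of
  \<open>f\<close> away from \<open>x\<close> while keeping that of \<open>k\<close> at \<open>x\<close> shows that \<open>L\<close> is a subgradient of \<open>f\<close>; shifting that
  of \<open>k\<close> while keeping that of \<open>f\<close> shows that \<open>- L\<close> is a subgradient of \<open>k\<close>. Finally
  \<open>L\<close> is bounded because it is dominated by the increments of \<open>f\<close>, which is continuous at \<open>x\<close>.
\<close>

lemma subdifferential_add_decompose:
  fixes f g :: "'a::real_normed_vector \<Rightarrow> real"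
  assumes f: "convex_on UNIV f" and g: "convex_on UNIV g" and cont: "isCont f x"
    and xs: "xs \<in> subdifferential (\<lambda>u. f u + g u) x"
  obtains a b where "a \<in> subdifferential f x" "b \<in> subdifferential g x" "xs = a + b"
proof -
  have jf: "f (u *\<^sub>R a + v *\<^sub>R b) \<le> u * f a + v * f b"
    and jg: "g (u *\<^sub>R a + v *\<^sub>R b) \<le> u * g a + v * g b"
    if "u \<ge> 0" "v \<ge> 0" "u + v = 1" for u v a b
    using f g that by (simp_all add: convex_on_def)
  define k where "k v = g v - blinfun_apply xs v" for v
  have jk: "k (u *\<^sub>R a + v *\<^sub>R b) \<le> u * k a + v * k b"
    if "u \<ge> 0" "v \<ge> 0" "u + v = 1" for u v a b
    using jg[OF that, of a b] by (simp add: k_def blinfun.add_right blinfun.scaleR_right algebra_simps)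
  have min: "f x + k x \<le> f v + k v" for v
    using xs by (auto simp: subdifferential_def k_def blinfun.diff_right algebra_simps dest: spec[of _ v])
  define S where "S h = range (\<lambda>v. f (v + h) + k v)" for h
  define \<Phi> where "\<Phi> h = Inf (S h)" for h
  have ne: "S h \<noteq> {}" for h by (simp add: S_def)
  have bdd: "bdd_below (S h)" for h
    unfolding S_def
  proof (rule bdd_belowI2[of _ "2 * (f x + k x) - (f (x - h) + k x)"])
    fix v
    \<comment> \<open>The shift \<open>h\<close> at \<open>v\<close> and the shift \<open>- h\<close> at \<open>x\<close> cancel at the midpoint,
      where the sum is at least its minimum.\<close>
    have "(1/2) *\<^sub>R (v + h) + (1/2) *\<^sub>R (x - h) = (1/2) *\<^sub>R v + (1/2) *\<^sub>R x"
      by (simp add: algebra_simps)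
    then show "2 * (f x + k x) - (f (x - h) + k x) \<le> f (v + h) + k v"
      using min[of "(1/2) *\<^sub>R v + (1/2) *\<^sub>R x"] jf[of "1/2" "1/2" "v + h" "x - h"]
        jk[of "1/2" "1/2" v x] by simp
  qed
  have \<Phi>_le: "\<Phi> h \<le> f (v + h) + k v" for h v
    unfolding \<Phi>_def by (intro cInf_lower bdd) (simp add: S_def)
  have \<Phi>_0: "f x + k x \<le> \<Phi> 0"
    unfolding \<Phi>_def using min by (intro cInf_greatest ne) (auto simp: S_def)
  have "convex_on UNIV \<Phi>"
    unfolding convex_on_def
  proof (intro conjI ballI allI impI)
    fix h l and u v :: real
    assume uv: "u \<ge> 0" "v \<ge> 0" "u + v = 1"
    have "\<exists>c\<in>S (u *\<^sub>R h + v *\<^sub>R l). c \<le> u * a + v * b" if ab: "a \<in> S h" "b \<in> S l" for a b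
    proof -
      obtain p q where pq: "a = f (p + h) + k p" "b = f (q + l) + k q"
        using ab by (auto simp: S_def)
      let ?w = "u *\<^sub>R p + v *\<^sub>R q"
      have "?w + (u *\<^sub>R h + v *\<^sub>R l) = u *\<^sub>R (p + h) + v *\<^sub>R (q + l)"
        by (simp add: algebra_simps)
      then have "f (?w + (u *\<^sub>R h + v *\<^sub>R l)) + k ?w \<le> u * a + v * b"
        using jf[OF uv, of "p + h" "q + l"] jk[OF uv, of p q] by (simp add: pq algebra_simps)
      then show ?thesis by (auto simp: S_def)
    qed
    then show "\<Phi> (u *\<^sub>R h + v *\<^sub>R l) \<le> u * \<Phi> h + v * \<Phi> l"
      unfolding \<Phi>_def by (intro cInf_linear_combination_le) (use ne bdd uv in auto)
  qed simp
  then obtain L where L: "linear L" "\<And>h. L h \<le> \<Phi> (0 + h) - \<Phi> 0"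
    using convex_on_algebraic_subgradient by blast
  have L_le: "L h \<le> f (v + h) + k v - (f x + k x)" for h v
    using L(2)[of h] \<Phi>_le[of h v] \<Phi>_0 by simp
  have L_f: "L h \<le> f (x + h) - f x" for h
    using L_le[of h x] by simp
  then have "bounded_linear L"
    using linear_minorant_bounded L(1) cont by blast
  then have app: "blinfun_apply (Blinfun L) = L"
    by (rule bounded_linear_Blinfun_apply)
  show thesis
  proof (rule that[of "Blinfun L" "xs - Blinfun L"])
    show "Blinfun L \<in> subdifferential f x"
      using L_f[of "y - x" for y] by (simp add: subdifferential_def app)
    show "xs - Blinfun L \<in> subdifferential g x"
      unfolding subdifferential_def
    proof (intro CollectI allI)
      fix y
      show "blinfun_apply (xs - Blinfun L) (y - x) \<le> g y - g x"
        using L_le[of "x - y" y] linear_diff[OF L(1)]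
        by (simp add: app k_def blinfun.diff_left blinfun.diff_right)
    qed
  qed simp
qed

lemma subdifferential_add:
  fixes f g :: "'a::real_normed_vector \<Rightarrow> real"
  assumes "convex_on UNIV f" "convex_on UNIV g" "isCont f x"
  shows "subdifferential (\<lambda>u. f u + g u) x = subdifferential f x + subdifferential g x"
proof
  show "subdifferential (\<lambda>u. f u + g u) x \<subseteq> subdifferential f x + subdifferential g x"
    using subdifferential_add_decompose[OF assms] by blast
  show "subdifferential f x + subdifferential g x \<subseteq> subdifferential (\<lambda>u. f u + g u) x"
  proof
    fix xs
    assume "xs \<in> subdifferential f x + subdifferential g x"
    then obtain a b where "xs = a + b"
      "\<And>y. blinfun_apply a (y - x) \<le> f y - f x" "\<And>y. blinfun_apply b (y - x) \<le> g y - g x"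
      by (auto simp: set_plus_def subdifferential_def)
    then have "blinfun_apply xs (y - x) \<le> (f y - f x) + (g y - g x)" for y
      by (simp add: blinfun.add_left add_mono)
    then show "xs \<in> subdifferential (\<lambda>u. f u + g u) x"
      by (simp add: subdifferential_def add_diff_add)
  qed
qed

lemma subdifferential_const:
  fixes x :: "'a::real_normed_vector"
  shows "subdifferential (\<lambda>u. c) x = {0}"
proof
  show "subdifferential (\<lambda>u. c) x \<subseteq> {0}"
  proof
    fix xs
    assume xs: "xs \<in> subdifferential (\<lambda>u. c) x"
    then have le: "blinfun_apply xs h \<le> 0" for h
      by (auto simp: subdifferential_def dest: spec[of _ "x + h"])
    have "blinfun_apply xs h = 0" for h
      using le[of h] le[of "- h"] by (simp add: blinfun.minus_right)
    then show "xs \<in> {0}" by (simp add: blinfun_eqI)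
  qed
qed (simp add: subdifferential_def)

lemma subdifferential_sum:
  fixes f :: "'i \<Rightarrow> 'a::real_normed_vector \<Rightarrow> real"
  assumes "finite I" and "\<And>i. i \<in> I \<Longrightarrow> convex_on UNIV (f i)" and "\<And>i. i \<in> I \<Longrightarrow> isCont (f i) x"
  shows "subdifferential (\<lambda>u. \<Sum>i\<in>I. f i u) x = (\<Sum>i\<in>I. subdifferential (f i) x)"
proof -
  have "convex_on UNIV (\<lambda>u. \<Sum>i\<in>I. f i u) \<and>
    subdifferential (\<lambda>u. \<Sum>i\<in>I. f i u) x = (\<Sum>i\<in>I. subdifferential (f i) x)"
    using assms
  proof (induction I rule: finite_induct)
    case empty
    then show ?case by (simp add: subdifferential_const convex_on_const)
  next
    case (insert i I)
    then show ?case by (simp add: subdifferential_add convex_on_add)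
  qed
  then show ?thesis ..
qed

lemma minimizer_iff_zero_subgradient:
  "(\<forall>x. f xbar \<le> f x) \<longleftrightarrow> 0 \<in> subdifferential f xbar"
  by (simp add: subdifferential_def)

section \<open>The Minkowski gauge\<close>

locale gauge_body =
  fixes F :: "'a::real_normed_vector set"
  assumes closed_F: "closed F" and bounded_F: "bounded F" and convex_F: "convex F"
    and zero_interior: "0 \<in> interior F"
begin

lemma zero_mem: "0 \<in> F"
  using zero_interior interior_subset by blast

text \<open>
  A convex set containing \<open>0\<close> is star-shaped about \<open>0\<close>. Hence the admissible scaling factors of a
  point are closed upwards, and their infimum, the gauge, decides membership for all factors above it.
\<close>

lemma scaled_body_mono:
  assumes "x \<in> (\<lambda>f. s *\<^sub>R f) ` F" "0 \<le> s" "s \<le> t"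
  shows "x \<in> (\<lambda>f. t *\<^sub>R f) ` F"
proof (cases "t = 0")
  case False
  then have t: "t > 0" using assms by simp
  obtain f where f: "f \<in> F" "x = s *\<^sub>R f" using assms by blast
  have "(s / t) *\<^sub>R f + (1 - s / t) *\<^sub>R 0 \<in> F"
    using f zero_mem assms t by (intro convexD[OF convex_F]) auto
  moreover have "x = t *\<^sub>R ((s / t) *\<^sub>R f + (1 - s / t) *\<^sub>R 0)"
    using t f by simp
  ultimately show ?thesis by blast
qed (use assms in auto)

lemma scaled_body_absorbs:
  obtains C where "C > 0" "\<And>x. x \<in> (\<lambda>f. (C * norm x) *\<^sub>R f) ` F"
proof -
  obtain e where e: "e > 0" "cball 0 e \<subseteq> F"
    using zero_interior mem_interior_cball by blast
  show thesis
  proof (rule that[of "1 / e"])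
    fix x :: 'a
    show "x \<in> (\<lambda>f. (1 / e * norm x) *\<^sub>R f) ` F"
    proof (cases "x = 0")
      case False
      have "(e / norm x) *\<^sub>R x \<in> F" using e False by (intro subsetD[OF e(2)]) simp
      moreover have "x = (1 / e * norm x) *\<^sub>R ((e / norm x) *\<^sub>R x)"
        using e False by simp
      ultimately show ?thesis by blast
    qed (use zero_mem in auto)
  qed (use e in simp)
qed

text \<open>
  The infimum defining the gauge is attained. For a positive value this is closedness of \<open>F\<close>; for the
  value \<open>0\<close> it is boundedness, since a point in \<open>s F\<close> for all \<open>s > 0\<close> must be \<open>0\<close>. This
  makes the gauge an exact substitute for the sets \<open>t F\<close> in the definitions of minimal
  time and projection.
\<close>

lemma gauge_nonneg: "gauge_fun F x \<ge> 0"
  and gauge_le_iff: "t \<ge> 0 \<Longrightarrow> gauge_fun F x \<le> t \<longleftrightarrow> x \<in> (\<lambda>f. t *\<^sub>R f) ` F"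
proof -
  define S where "S = {t. t \<ge> 0 \<and> x \<in> (\<lambda>f. t *\<^sub>R f) ` F}"
  have gauge: "gauge_fun F x = Inf S" by (simp add: gauge_fun_def S_def)
  have ne: "S \<noteq> {}"
  proof -
    obtain C where "C > 0" "x \<in> (\<lambda>f. (C * norm x) *\<^sub>R f) ` F"
      using scaled_body_absorbs by metis
    then have "C * norm x \<in> S" by (simp add: S_def)
    then show ?thesis by blast
  qed
  have bdd: "bdd_below S" by (rule bdd_belowI[of _ 0]) (simp add: S_def)
  show "gauge_fun F x \<ge> 0"
    unfolding gauge by (rule cInf_greatest[OF ne]) (simp add: S_def)
  show "gauge_fun F x \<le> t \<longleftrightarrow> x \<in> (\<lambda>f. t *\<^sub>R f) ` F" if t: "t \<ge> 0"
  proof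
    assume "x \<in> (\<lambda>f. t *\<^sub>R f) ` F"
    then show "gauge_fun F x \<le> t"
      unfolding gauge using t by (intro cInf_lower bdd) (simp add: S_def)
  next
    assume le: "gauge_fun F x \<le> t"
    have above: "x \<in> (\<lambda>f. s *\<^sub>R f) ` F" if s_gt: "s > t" for s
    proof -
      obtain r where "r \<in> S" "r < s"
        using cInf_lessD[OF ne, of s] le s_gt gauge by auto
      then show ?thesis using scaled_body_mono[of x r s] by (simp add: S_def)
    qed
    show "x \<in> (\<lambda>f. t *\<^sub>R f) ` F"
    proof (cases "t = 0")
      case True
      obtain B where B: "B > 0" "\<And>f. f \<in> F \<Longrightarrow> norm f \<le> B"
        using bounded_F by (meson bounded_pos)
      have "norm x \<le> 0 + e" if "e > 0" for e
      proof -
        have "e / B > t" using that B True by simp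
        then obtain f where "f \<in> F" "x = (e / B) *\<^sub>R f" using above by blast
        then show ?thesis using B that by (simp add: field_simps)
      qed
      then have "x = 0" using field_le_epsilon[of "norm x" 0] by simp
      then show ?thesis using True zero_mem by auto
    next
      case False
      with t have "t > 0" by simp
      have "(1 / (t + 1 / Suc n)) *\<^sub>R x \<in> F" for n
      proof -
        obtain f where "f \<in> F" "x = (t + 1 / Suc n) *\<^sub>R f"
          using above[of "t + 1 / Suc n"] by auto
        moreover have "t + 1 / Suc n > 0" using \<open>t > 0\<close> by (simp add: add_pos_pos)
        ultimately show ?thesis by simp
      qed
      moreover have "(\<lambda>n. (1 / (t + 1 / Suc n)) *\<^sub>R x) \<longlonglongrightarrow> (1 / (t + 0)) *\<^sub>R x"
      proof (intro tendsto_intros)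
        show "(\<lambda>n. 1 / real (Suc n)) \<longlonglongrightarrow> 0"
          using LIMSEQ_inverse_real_of_nat by (simp only: inverse_eq_divide)
      qed (use \<open>t > 0\<close> in simp)
      ultimately have "(1 / (t + 0)) *\<^sub>R x \<in> F"
        by (rule closed_sequentially[OF closed_F])
      moreover have "x = t *\<^sub>R ((1 / (t + 0)) *\<^sub>R x)" using \<open>t > 0\<close> by simp
      ultimately show ?thesis by blast
    qed
  qed
qed

lemma gauge_mem: "x \<in> (\<lambda>f. gauge_fun F x *\<^sub>R f) ` F"
  using gauge_le_iff[OF gauge_nonneg, of x x] by simp

lemma gauge_le_norm:
  obtains C where "C > 0" "\<And>x. gauge_fun F x \<le> C * norm x"
proof -
  obtain C where "C > 0" "\<And>x. x \<in> (\<lambda>f. (C * norm x) *\<^sub>R f) ` F"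
    using scaled_body_absorbs by blast
  then show thesis using that[of C] gauge_le_iff by simp
qed

lemma gauge_scaleR_le:
  assumes "c \<ge> 0"
  shows "gauge_fun F (c *\<^sub>R x) \<le> c * gauge_fun F x"
proof -
  obtain f where "f \<in> F" "x = gauge_fun F x *\<^sub>R f" using gauge_mem[of x] by blast
  then have "c *\<^sub>R x \<in> (\<lambda>f. (c * gauge_fun F x) *\<^sub>R f) ` F"
    by (metis image_eqI scaleR_scaleR)
  then show ?thesis using assms gauge_nonneg by (simp add: gauge_le_iff)
qed

lemma gauge_triangle: "gauge_fun F (x + y) \<le> gauge_fun F x + gauge_fun F y"
proof (cases "gauge_fun F x + gauge_fun F y = 0")
  case True
  then have "gauge_fun F x = 0" "gauge_fun F y = 0"
    using gauge_nonneg[of x] gauge_nonneg[of y] by linarith+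
  then have "x = 0" "y = 0" using gauge_mem[of x] gauge_mem[of y] by auto
  with True show ?thesis using gauge_nonneg[of x] by simp
next
  case False
  define a b where "a = gauge_fun F x" and "b = gauge_fun F y"
  have ab: "a \<ge> 0" "b \<ge> 0" "a + b > 0"
    using False gauge_nonneg[of x] gauge_nonneg[of y] by (auto simp: a_def b_def)
  obtain f g where fg: "f \<in> F" "x = a *\<^sub>R f" "g \<in> F" "y = b *\<^sub>R g"
    using gauge_mem[of x] gauge_mem[of y] by (auto simp: a_def b_def)
  have "(a / (a + b)) *\<^sub>R f + (b / (a + b)) *\<^sub>R g \<in> F"
    using fg ab by (intro convexD[OF convex_F]) (auto simp: add_divide_distrib[symmetric])
  moreover have "x + y = (a + b) *\<^sub>R ((a / (a + b)) *\<^sub>R f + (b / (a + b)) *\<^sub>R g)"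
    using fg ab by (simp add: scaleR_add_right)
  ultimately have "x + y \<in> (\<lambda>f. (a + b) *\<^sub>R f) ` F" by blast
  then show ?thesis using ab by (simp add: gauge_le_iff a_def b_def)
qed

section \<open>The minimal time function and its subdifferential\<close>

lemma minimal_time_eq_Inf_gauge:
  assumes "\<Omega> \<noteq> {}"
  shows "minimal_time F \<Omega> x = Inf ((\<lambda>\<omega>. gauge_fun F (\<omega> - x)) ` \<Omega>)"
proof -
  define S where "S = {t. t \<ge> 0 \<and> \<Omega> \<inter> (\<lambda>f. x + t *\<^sub>R f) ` F \<noteq> {}}"
  have S: "t \<in> S \<longleftrightarrow> t \<ge> 0 \<and> (\<exists>\<omega>\<in>\<Omega>. gauge_fun F (\<omega> - x) \<le> t)" for t
  proof -
    have "\<omega> \<in> (\<lambda>f. x + t *\<^sub>R f) ` F \<longleftrightarrow> \<omega> - x \<in> (\<lambda>f. t *\<^sub>R f) ` F" for \<omega>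
      by (auto simp: image_iff algebra_simps)
    then have "(\<exists>\<omega>\<in>\<Omega>. \<omega> \<in> (\<lambda>f. x + t *\<^sub>R f) ` F) \<longleftrightarrow> (\<exists>\<omega>\<in>\<Omega>. gauge_fun F (\<omega> - x) \<le> t)" if "t \<ge> 0"
      using that by (simp only: gauge_le_iff)
    moreover have "t \<in> S \<longleftrightarrow> t \<ge> 0 \<and> (\<exists>\<omega>\<in>\<Omega>. \<omega> \<in> (\<lambda>f. x + t *\<^sub>R f) ` F)"
      unfolding S_def by blast
    ultimately show ?thesis by blast
  qed
  have "Inf ((\<lambda>\<omega>. gauge_fun F (\<omega> - x)) ` \<Omega>) = Inf S"
  proof (rule antisym)
    obtain \<omega> where "\<omega> \<in> \<Omega>" using assms by blast
    then have ne: "S \<noteq> {}" using S gauge_nonneg by blast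
    have "bdd_below ((\<lambda>\<omega>. gauge_fun F (\<omega> - x)) ` \<Omega>)"
      using gauge_nonneg by (intro bdd_belowI2)
    then show "Inf ((\<lambda>\<omega>. gauge_fun F (\<omega> - x)) ` \<Omega>) \<le> Inf S"
      using S by (intro cInf_greatest[OF ne]) (auto intro: cInf_lower2)
    have "bdd_below S" using S by (intro bdd_belowI[of _ 0]) auto
    then show "Inf S \<le> Inf ((\<lambda>\<omega>. gauge_fun F (\<omega> - x)) ` \<Omega>)"
      using assms S gauge_nonneg by (intro cINF_greatest) (auto intro!: cInf_lower)
  qed
  then show ?thesis by (simp add: minimal_time_def S_def)
qed

lemma minimal_time_le_gauge:
  assumes "\<omega> \<in> \<Omega>"
  shows "minimal_time F \<Omega> x \<le> gauge_fun F (\<omega> - x)"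
proof -
  have "bdd_below ((\<lambda>\<omega>. gauge_fun F (\<omega> - x)) ` \<Omega>)"
    using gauge_nonneg by (intro bdd_belowI2)
  then show ?thesis
    using assms by (subst minimal_time_eq_Inf_gauge) (auto intro: cInf_lower)
qed

lemma minimal_time_greatest:
  assumes "\<Omega> \<noteq> {}" "\<And>\<omega>. \<omega> \<in> \<Omega> \<Longrightarrow> c \<le> gauge_fun F (\<omega> - x)"
  shows "c \<le> minimal_time F \<Omega> x"
  using assms by (simp add: minimal_time_eq_Inf_gauge cINF_greatest)

lemma minimal_time_nonneg: "\<Omega> \<noteq> {} \<Longrightarrow> minimal_time F \<Omega> x \<ge> 0"
  using minimal_time_greatest gauge_nonneg by blast

lemma minimal_time_convex:
  assumes "\<Omega> \<noteq> {}" "convex \<Omega>"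
  shows "convex_on UNIV (minimal_time F \<Omega>)"
  unfolding convex_on_def
proof (intro conjI ballI allI impI)
  fix x y and u v :: real
  assume uv: "u \<ge> 0" "v \<ge> 0" "u + v = 1"
  let ?S = "\<lambda>x. (\<lambda>\<omega>. gauge_fun F (\<omega> - x)) ` \<Omega>"
  have "\<exists>c\<in>?S (u *\<^sub>R x + v *\<^sub>R y). c \<le> u * a + v * b" if ab: "a \<in> ?S x" "b \<in> ?S y" for a b
  proof -
    obtain p q where pq: "p \<in> \<Omega>" "q \<in> \<Omega>" "a = gauge_fun F (p - x)" "b = gauge_fun F (q - y)"
      using ab by blast
    have "u *\<^sub>R p + v *\<^sub>R q \<in> \<Omega>" using convexD[OF assms(2)] pq uv by blast
    moreover have "gauge_fun F (u *\<^sub>R p + v *\<^sub>R q - (u *\<^sub>R x + v *\<^sub>R y)) \<le> u * a + v * b"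
    proof -
      have "u *\<^sub>R p + v *\<^sub>R q - (u *\<^sub>R x + v *\<^sub>R y) = u *\<^sub>R (p - x) + v *\<^sub>R (q - y)"
        by (simp add: algebra_simps)
      then show ?thesis
        using gauge_triangle[of "u *\<^sub>R (p - x)" "v *\<^sub>R (q - y)"]
          gauge_scaleR_le[OF uv(1), of "p - x"] gauge_scaleR_le[OF uv(2), of "q - y"] pq by simp
    qed
    ultimately show ?thesis by blast
  qed
  moreover have "bdd_below (?S z)" for z
    using gauge_nonneg by (intro bdd_belowI2)
  ultimately show "minimal_time F \<Omega> (u *\<^sub>R x + v *\<^sub>R y)
      \<le> u * minimal_time F \<Omega> x + v * minimal_time F \<Omega> y"
    using assms(1) uv
    by (simp add: minimal_time_eq_Inf_gauge) (intro cInf_linear_combination_le, auto)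
qed simp

text \<open>
  To reach the target from \<open>y\<close>, one may first go to \<open>x\<close>. With the bound of the gauge by the norm this
  makes the minimal time Lipschitz.
\<close>

lemma minimal_time_le_add_gauge:
  assumes "\<Omega> \<noteq> {}"
  shows "minimal_time F \<Omega> y \<le> minimal_time F \<Omega> x + gauge_fun F (x - y)"
proof -
  have "minimal_time F \<Omega> y - gauge_fun F (x - y) \<le> minimal_time F \<Omega> x"
  proof (rule minimal_time_greatest[OF assms])
    fix \<omega> assume "\<omega> \<in> \<Omega>"
    then show "minimal_time F \<Omega> y - gauge_fun F (x - y) \<le> gauge_fun F (\<omega> - x)"
      using minimal_time_le_gauge[of \<omega> \<Omega> y] gauge_triangle[of "\<omega> - x" "x - y"] by simp
  qed
  then show ?thesis by simp
qed

lemma minimal_time_isCont: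
  assumes "\<Omega> \<noteq> {}"
  shows "isCont (minimal_time F \<Omega>) x"
proof -
  obtain C where C: "C > 0" "\<And>x. gauge_fun F x \<le> C * norm x" using gauge_le_norm by blast
  have "C-lipschitz_on UNIV (minimal_time F \<Omega>)"
  proof (rule lipschitz_onI)
    fix x y
    have "gauge_fun F (x - y) \<le> C * norm (x - y)" "gauge_fun F (y - x) \<le> C * norm (x - y)"
      using C(2)[of "x - y"] C(2)[of "y - x"] by (simp_all add: norm_minus_commute)
    then show "dist (minimal_time F \<Omega> x) (minimal_time F \<Omega> y) \<le> C * dist x y"
      using minimal_time_le_add_gauge[OF assms, of x y] minimal_time_le_add_gauge[OF assms, of y x]
      by (simp add: dist_norm abs_le_iff)
  qed (use C in simp)
  then show ?thesis
    using lipschitz_on_continuous_on continuous_on_eq_continuous_at open_UNIV by blast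
qed

text \<open>
  Projections are the points of the target where the infimum of gauges is attained: membership in the
  scaled set only says that the gauge is at most the minimal time, but the other inequality holds for
  every point of the target.
\<close>

lemma gen_projection_iff:
  "\<omega> \<in> gen_projection F \<Omega> x \<longleftrightarrow> \<omega> \<in> \<Omega> \<and> gauge_fun F (\<omega> - x) = minimal_time F \<Omega> x"
proof (cases "\<omega> \<in> \<Omega>")
  case True
  then have "minimal_time F \<Omega> x \<ge> 0" using minimal_time_nonneg by blast
  moreover have "\<omega> \<in> (\<lambda>f. x + t *\<^sub>R f) ` F \<longleftrightarrow> \<omega> - x \<in> (\<lambda>f. t *\<^sub>R f) ` F" for t
    by (auto simp: image_iff algebra_simps)
  ultimately show ?thesis
    using True minimal_time_le_gauge[OF True, of x] by (auto simp: gen_projection_def gauge_le_iff[symmetric])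
qed (simp add: gen_projection_def)

lemma self_mem_gen_projection:
  assumes "x \<in> \<Omega>"
  shows "x \<in> gen_projection F \<Omega> x"
proof -
  have "gauge_fun F 0 \<le> 0" using gauge_le_iff[of 0 0] zero_mem by auto
  then have "gauge_fun F 0 = 0" using gauge_nonneg[of 0] by linarith
  then show ?thesis
    using assms minimal_time_le_gauge[OF assms, of x] minimal_time_nonneg[of \<Omega> x]
    by (auto simp: gen_projection_iff)
qed

text \<open>
  The right-hand side does not mention \<open>\<omega>\<close>, so the left-hand side is the same for all
  projection points. Testing a subgradient of the minimal time function at \<open>x + (z - \<omega>)\<close>, from which
  \<open>z \<in> \<Omega>\<close> is reached as fast as \<open>\<omega>\<close> is from \<open>x\<close>, gives the normal cone condition; testing it at
  \<open>\<omega> - v\<close>, from which \<open>\<omega>\<close> is reached in time \<open>\<rho> v\<close> for the gauge \<open>\<rho>\<close> of \<open>F\<close>, gives the condition on \<open>\<rho>\<close>.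
  Conversely, the two conditions add up along \<open>y - x = (z - \<omega>) - ((z - y) - (\<omega> - x))\<close>.
\<close>

lemma normal_subgradients_eq_subdifferential:
  assumes "\<omega> \<in> gen_projection F \<Omega> x"
  shows "normal_subgradients F \<Omega> x \<omega> = subdifferential (minimal_time F \<Omega>) x"
proof
  have \<omega>: "\<omega> \<in> \<Omega>" and eq: "gauge_fun F (\<omega> - x) = minimal_time F \<Omega> x"
    using assms by (auto simp: gen_projection_iff)
  show "normal_subgradients F \<Omega> x \<omega> \<subseteq> subdifferential (minimal_time F \<Omega>) x"
  proof
    fix xs
    assume "xs \<in> normal_subgradients F \<Omega> x \<omega>"
    then have sub: "blinfun_apply (- xs) (v - (\<omega> - x)) \<le> gauge_fun F v - gauge_fun F (\<omega> - x)"
      and nrm: "z \<in> \<Omega> \<Longrightarrow> blinfun_apply xs (z - \<omega>) \<le> 0" for v z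
      by (auto simp: normal_subgradients_def subdifferential_def normal_cone_def)
    have "blinfun_apply xs (y - x) + minimal_time F \<Omega> x \<le> minimal_time F \<Omega> y" for y
    proof (rule minimal_time_greatest)
      fix z assume "z \<in> \<Omega>"
      then show "blinfun_apply xs (y - x) + minimal_time F \<Omega> x \<le> gauge_fun F (z - y)"
        using sub[of "z - y"] nrm[of z] eq
        by (simp add: blinfun.minus_left blinfun.diff_right)
    qed (use \<omega> in blast)
    then show "xs \<in> subdifferential (minimal_time F \<Omega>) x"
      by (simp add: subdifferential_def le_diff_eq)
  qed
  show "subdifferential (minimal_time F \<Omega>) x \<subseteq> normal_subgradients F \<Omega> x \<omega>"
  proof
    fix xs
    assume "xs \<in> subdifferential (minimal_time F \<Omega>) x"
    then have sub: "blinfun_apply xs (y - x) \<le> minimal_time F \<Omega> y - minimal_time F \<Omega> x" for y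
      by (simp add: subdifferential_def)
    have "xs \<in> normal_cone \<omega> \<Omega>"
      unfolding normal_cone_def
    proof (intro CollectI ballI)
      fix z assume "z \<in> \<Omega>"
      then show "blinfun_apply xs (z - \<omega>) \<le> 0"
        using sub[of "x + (z - \<omega>)"] minimal_time_le_gauge[of z \<Omega> "x + (z - \<omega>)"] eq by simp
    qed
    moreover have "- xs \<in> subdifferential (gauge_fun F) (\<omega> - x)"
      unfolding subdifferential_def
    proof (intro CollectI allI)
      fix v
      show "blinfun_apply (- xs) (v - (\<omega> - x)) \<le> gauge_fun F v - gauge_fun F (\<omega> - x)"
        using sub[of "\<omega> - v"] minimal_time_le_gauge[OF \<omega>, of "\<omega> - v"] eq
        by (simp add: blinfun.minus_left blinfun.diff_right)
    qed
    ultimately show "xs \<in> normal_subgradients F \<Omega> x \<omega>"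
      unfolding normal_subgradients_def by (metis IntI image_eqI minus_minus)
  qed
qed

lemma A_set_eq_subdifferential:
  assumes "gen_projection F \<Omega> x \<noteq> {}"
  shows "A_set F \<Omega> x = subdifferential (minimal_time F \<Omega>) x"
  using assms by (auto simp: A_set_def normal_subgradients_eq_subdifferential)

end

section \<open>Optimality in the generalized Fermat-Torricelli problem\<close>

theorem theorem4p6:
  fixes F :: "'a::banach set"
    and \<Omega> :: "nat \<Rightarrow> 'a set"
    and n :: nat
    and xbar :: 'a
  assumes "F \<noteq> {}" and "closed F" and "bounded F" and "convex F" and "0 \<in> interior F"
    and "\<forall>i\<in>{1..n}. \<Omega> i \<noteq> {} \<and> closed (\<Omega> i) \<and> convex (\<Omega> i)"
    and "\<forall>i\<in>{1..n}. xbar \<notin> \<Omega> i \<longrightarrow> gen_projection F (\<Omega> i) xbar \<noteq> {}"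
  shows "(\<forall>i\<in>{1..n}. \<forall>\<omega>\<in>gen_projection F (\<Omega> i) xbar.
            A_set F (\<Omega> i) xbar = normal_subgradients F (\<Omega> i) xbar \<omega>) \<and>
         ((\<forall>x. (\<Sum>i=1..n. minimal_time F (\<Omega> i) xbar) \<le> (\<Sum>i=1..n. minimal_time F (\<Omega> i) x))
            \<longleftrightarrow> 0 \<in> (\<Sum>i=1..n. A_set F (\<Omega> i) xbar))"
proof -
  interpret gauge_body F
    using assms(2-5) by unfold_locales
  have projection: "gen_projection F (\<Omega> i) xbar \<noteq> {}" if "i \<in> {1..n}" for i
    using assms(7) self_mem_gen_projection that by blast
  have A: "A_set F (\<Omega> i) xbar = subdifferential (minimal_time F (\<Omega> i)) xbar" if "i \<in> {1..n}" for i
    using projection[OF that] by (rule A_set_eq_subdifferential)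
  have "(\<Sum>i=1..n. A_set F (\<Omega> i) xbar)
      = (\<Sum>i=1..n. subdifferential (minimal_time F (\<Omega> i)) xbar)"
    using A by simp
  also have "\<dots> = subdifferential (\<lambda>x. \<Sum>i=1..n. minimal_time F (\<Omega> i) x) xbar"
    by (rule subdifferential_sum[symmetric])
      (use assms(6) minimal_time_convex minimal_time_isCont in auto)
  finally have sum: "(\<Sum>i=1..n. A_set F (\<Omega> i) xbar)
      = subdifferential (\<lambda>x. \<Sum>i=1..n. minimal_time F (\<Omega> i) x) xbar" .
  show ?thesis
    unfolding sum minimizer_iff_zero_subgradient[of "\<lambda>x. \<Sum>i=1..n. minimal_time F (\<Omega> i) x" xbar]
    using A by (simp add: normal_subgradients_eq_subdifferential)
qed

end
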